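(* For all integers $p,q\ge 0$ and $n,m\ge 0$, and all $z,w,\gamma\in\mathbb{C}$ with $z,w\neq 0$, $$H_{n,m}^{(p,q)}(z,w|\gamma)=z^{n}w^{m}\;{}_{p+q}F_0\left(\begin{array}{c}\frac{-n}{p},\frac{1-n}{p},\cdots,\frac{p-1-n}{p},\frac{-m}{q},\frac{1-m}{q},\cdots,\frac{q-1-m}{q}\\ -\end{array}\bigg|\;\frac{(-p)^{p}(-q)^{q}\gamma}{z^{p}w^{q}}\right).$$
   Context: For integers $p,q,n,m\ge0$ and complex $z,w,\gamma$, $$H_{n,m}^{(p,q)}(z,w|\gamma)= n!\,m!\sum_{k=0}^{\lfloor n/p\rfloor\wedge\lfloor m/q\rfloor}\frac{\gamma^k}{k!}\frac{z^{n-pk}}{(n-pk)!}\frac{w^{m-qk}}{(m-qk)!},$$ where $a\wedge b=\min\{a,b\}$, with the convention $\lfloor j/k\rfloor=+\infty$ when $k=0$ (so that, for example, $H_{0,0}^{(0,0)}(z,w|\gamma)=e^{\gamma}$). The hypergeometric series is $${}_rF_s\left(\begin{array}{c}a_1,\dots,a_r\\ c_1,\dots,c_s\end{array}\bigg|\,x\right)=\sum_{k=0}^\infty\frac{(a_1)_k\cdots(a_r)_k}{(c_1)_k\cdots(c_s)_k}\frac{x^k}{k!},$$ with $(a)_k=a(a+1)\cdots(a+k-1)$, $(a)_0=1$, empty products being $1$. The upper parameters in the claim consist of the $p$ numbers $\frac{j-1-n}{p}$, $1\le j\le p$, and the $q$ numbers $\frac{j-1-m}{q}$, $1\le j\le q$.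 When $p=0$ (respectively $q=0$) the first (respectively second) list is empty and $(-p)^p$ (respectively $(-q)^q$) is read as $1$. *)

theory Defs
  imports "HOL-Analysis.Analysis" "HOL-Library.Extended_Nat"
begin

definition floor_quot :: "nat \<Rightarrow> nat \<Rightarrow> enat" where
  "floor_quot j k = (if k = 0 then \<infinity> else enat (j div k))"

text \<open>The index set is finite, and the sum an ordinary finite sum, unless \<open>p = q = 0\<close>, in which
  case the summation runs over all natural numbers and is absolutely convergent. The natural
  number subtractions are never truncated on the index set.\<close>

definition ito_hermite ::
  "nat \<Rightarrow> nat \<Rightarrow> nat \<Rightarrow> nat \<Rightarrow> complex \<Rightarrow> complex \<Rightarrow> complex \<Rightarrow> complex" where
  "ito_hermite p q n m z w \<gamma> =
     fact n * fact m *
     (\<Sum>\<^sub>\<infinity>k\<in>{k. enat k \<le> min (floor_quot n p) (floor_quot m q)}.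
        \<gamma> ^ k / fact k * (z ^ (n - p * k) / fact (n - p * k)) * (w ^ (m - q * k) / fact (m - q * k)))"

text \<open>The argument \<open>as\<close> lists the upper parameters and \<open>cs\<close> the lower ones.\<close>

definition hypergeom_term :: "complex list \<Rightarrow> complex list \<Rightarrow> complex \<Rightarrow> nat \<Rightarrow> complex" where
  "hypergeom_term as cs x k =
     (\<Prod>a\<leftarrow>as. pochhammer a k) / (\<Prod>c\<leftarrow>cs. pochhammer c k) * (x ^ k / fact k)"

definition hypergeom :: "complex list \<Rightarrow> complex list \<Rightarrow> complex \<Rightarrow> complex" where
  "hypergeom as cs x = (\<Sum>k. hypergeom_term as cs x k)"

definition shifted_params :: "nat \<Rightarrow> nat \<Rightarrow> complex list" where
  "shifted_params p n = map (\<lambda>j. (of_nat j - of_nat n) / of_nat p) [0..<p]"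

lemma ito_hermite_0_0: "ito_hermite 0 0 0 0 z w \<gamma> = exp \<gamma>"
proof -
  have "summable (\<lambda>k. norm (\<gamma> ^ k / fact k))"
    using summable_norm_exp[of \<gamma>] by (simp add: scaleR_conv_of_real field_simps norm_divide norm_mult)
  moreover have "(\<lambda>k. \<gamma> ^ k / fact k) sums exp \<gamma>"
    using exp_converges[of \<gamma>] by (simp add: scaleR_conv_of_real field_simps)
  ultimately have "((\<lambda>k. \<gamma> ^ k / fact k) has_sum exp \<gamma>) UNIV"
    by (rule norm_summable_imp_has_sum)
  then show ?thesis
    by (simp add: ito_hermite_def floor_quot_def infsumI)
qed

text \<open>The series in the main statement converges, so its value is never the
  default value that \<open>suminf\<close> takes on a divergent series.\<close>

lemma prod_list_shifted_params_eq_0: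
  assumes "p > 0" "k > n"
  shows "(\<Prod>a\<leftarrow>shifted_params p n. pochhammer a k) = 0"
proof -
  let ?a = "(of_nat (n mod p) - of_nat n) / of_nat p :: complex"
  have "(of_nat n :: complex) = of_nat (n mod p) + of_nat p * of_nat (n div p)"
    by (metis mod_mult_div_eq of_nat_add of_nat_mult)
  then have "?a = - of_nat (n div p)"
    using assms by (simp add: field_simps)
  moreover have "n div p < k"
    using assms by (meson div_le_dividend le_less_trans)
  ultimately have "pochhammer ?a k = 0"
    by (simp add: pochhammer_of_nat_eq_0_iff)
  moreover have "?a \<in> set (shifted_params p n)"
    using assms by (auto simp: shifted_params_def)
  ultimately have "0 \<in> set (map (\<lambda>a. pochhammer a k) (shifted_params p n))"
    by (metis imageI set_map)
  then show ?thesis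
    by (simp add: prod_list_zero_iff)
qed

lemma summable_hypergeom_shifted_params:
  "summable (hypergeom_term (shifted_params p n @ shifted_params q m) [] x)"
proof (cases "p = 0 \<and> q = 0")
  case True
  have "summable (\<lambda>k. x ^ k / fact k)"
    using summable_exp_generic[of x] by (simp add: scaleR_conv_of_real field_simps)
  then show ?thesis
    using True by (simp add: hypergeom_term_def [abs_def] shifted_params_def)
next
  case False
  have "hypergeom_term (shifted_params p n @ shifted_params q m) [] x k = 0" if "k \<notin> {..n + m}" for k
    using False that prod_list_shifted_params_eq_0[of p n k] prod_list_shifted_params_eq_0[of q m k]
    by (auto simp: hypergeom_term_def)
  then show ?thesis
    by (intro summable_finite[of "{..n + m}"]) auto
qed

end

theory Submission imports Defs begin

text \<open>Multiplying each factor of \<open>((j - n)/p)\<^sub>k\<close> by \<open>-p\<close> and letting \<open>j\<close> run over \<open>0, \<dots>, p - 1\<close>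
  turns the product of these Pochhammer symbols into the falling factorial
  \<open>n (n - 1) \<cdots> (n - p k + 1)\<close>. It equals \<open>n! / (n - p k)!\<close> for \<open>p k \<le> n\<close> and vanishes otherwise,
  so the two series agree term by term.\<close>

text \<open>The binomial form of the falling factorial avoids a case split: for \<open>N > n\<close>
  the factor at \<open>t = n\<close> is zero, and so is \<open>n choose N\<close>.\<close>

lemma prod_diff_of_nat_eq_fact_binomial:
  "(\<Prod>t<N. of_nat n - of_nat t :: 'a :: field_char_0) = fact N * of_nat (n choose N)"
  by (simp add: binomial_gbinomial gbinomial_prod_rev atLeast0LessThan)

text \<open>A bound independent of \<open>k\<close>, used to dominate the hypergeometric
  terms.\<close>

lemma fact_mult_binomial_le: "fact k * (n choose k) \<le> (fact n :: nat)"
proof (cases "k \<le> n")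
  case True
  have "fact k * (n choose k) * 1 \<le> fact k * (n choose k) * (fact (n - k) :: nat)"
    by (intro mult_left_mono fact_ge_1) auto
  also have "\<dots> = fact n"
    using binomial_fact_lemma[OF True] by (simp add: mult_ac)
  finally show ?thesis by simp
qed (simp add: binomial_eq_0)

lemma fact_mult_binomial_eq_divide:
  assumes "k \<le> n"
  shows "fact k * of_nat (n choose k) = (fact n / fact (n - k) :: 'a :: field_char_0)"
  using assms by (simp add: binomial_fact)

lemma prod_block_Suc:
  fixes f :: "nat \<Rightarrow> 'a :: comm_monoid_mult"
  shows "(\<Prod>t<p * Suc k. f t) = (\<Prod>t<p * k. f t) * (\<Prod>j<p. f (p * k + j))"
proof -
  have "(\<Prod>t<p * Suc k. f t) = (\<Prod>t<p * k. f t) * (\<Prod>t=p * k..<p * k + p. f t)"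
    by (simp add: lessThan_atLeast0 prod.atLeastLessThan_concat add.commute)
  also have "(\<Prod>t=p * k..<p * k + p. f t) = (\<Prod>j<p. f (p * k + j))"
    using prod.shift_bounds_nat_ivl[of f 0 "p * k" p]
    by (simp add: lessThan_atLeast0 add.commute)
  finally show ?thesis .
qed

text \<open>Induction on \<open>k\<close>: each step extends the falling factorial by one block of
  \<open>p\<close> consecutive factors. For \<open>p = 0\<close> both sides are 1, since
  \<open>0 ^ 0 = 1\<close>.\<close>

lemma prod_pochhammer_shifted_params:
  "((- of_nat p) ^ p) ^ k * (\<Prod>a\<leftarrow>shifted_params p n. pochhammer a k) =
    fact (p * k) * of_nat (n choose (p * k))"
proof -
  have list: "(\<Prod>a\<leftarrow>shifted_params p n. pochhammer a k) =
      (\<Prod>j<p. pochhammer ((of_nat j - of_nat n) / of_nat p) k)" for k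
    by (simp add: shifted_params_def prod.distinct_set_conv_list[symmetric] comp_def
        atLeast0LessThan)
  have "((- of_nat p) ^ p) ^ k * (\<Prod>a\<leftarrow>shifted_params p n. pochhammer a k) =
      (\<Prod>t<p * k. of_nat n - of_nat t)"
  proof (induction k)
    case 0
    show ?case
      unfolding list by simp
  next
    case (Suc k)
    have "(- of_nat p :: complex) ^ p * (\<Prod>j<p. (of_nat j - of_nat n) / of_nat p + of_nat k) =
        (\<Prod>j<p. - of_nat p * ((of_nat j - of_nat n) / of_nat p + of_nat k))"
      by (simp only: prod.distrib prod_constant card_lessThan)
    \<comment> \<open>An index \<open>j < p\<close> forces \<open>p\<close> to be nonzero, so the
      denominator cancels.\<close>
    also have "\<dots> = (\<Prod>j<p. of_nat n - of_nat (p * k + j))"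
      by (intro prod.cong) (auto simp: field_simps)
    finally have step: "(- of_nat p :: complex) ^ p *
        (\<Prod>j<p. (of_nat j - of_nat n) / of_nat p + of_nat k) =
        (\<Prod>j<p. of_nat n - of_nat (p * k + j))" .
    show ?case
      using arg_cong2[OF Suc step, of "(*)"]
      unfolding list prod_block_Suc
      by (simp add: pochhammer_Suc prod.distrib mult_ac)
  qed
  then show ?thesis
    by (simp add: prod_diff_of_nat_eq_fact_binomial)
qed

lemma hypergeom_term_shifted_params:
  "hypergeom_term (shifted_params p n @ shifted_params q m) []
      ((- of_nat p) ^ p * (- of_nat q) ^ q * y) k =
    fact (p * k) * of_nat (n choose (p * k)) * (fact (q * k) * of_nat (m choose (q * k)))
      * (y ^ k / fact k)"
  unfolding prod_pochhammer_shifted_params[symmetric]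
  by (simp add: hypergeom_term_def power_mult_distrib)

text \<open>The falling factorials are at most \<open>fact n\<close> and \<open>fact m\<close>, so a
  multiple of the exponential series dominates. This treats the terminating series and the case
  \<open>p = q = 0\<close> alike.\<close>

lemma abs_summable_hypergeom_term_shifted_params:
  "summable (\<lambda>k. norm (hypergeom_term (shifted_params p n @ shifted_params q m) []
      ((- of_nat p) ^ p * (- of_nat q) ^ q * y) k))"
proof (rule summable_comparison_test')
  show "summable (\<lambda>k. fact n * fact m * (inverse (fact k) * norm y ^ k) :: real)"
    by (intro summable_mult summable_exp)
next
  fix k :: nat
  have le: "real (fact (r * k) * (l choose (r * k))) \<le> fact l" for r l
    using fact_mult_binomial_le[of "r * k" l] of_nat_mono by fastforce
  show "norm (norm (hypergeom_term (shifted_params p n @ shifted_params q m) []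
      ((- of_nat p) ^ p * (- of_nat q) ^ q * y) k))
      \<le> fact n * fact m * (inverse (fact k) * norm y ^ k)"
    using mult_right_mono[OF mult_mono[OF le[of p n] le[of q m]], of "inverse (fact k) * norm y ^ k"]
    unfolding hypergeom_term_shifted_params
    by (simp add: norm_mult norm_divide norm_power field_simps)
qed

text \<open>For \<open>r = 0\<close> both sides are true, which is where the convention of an
  infinite quotient enters.\<close>

lemma le_floor_quot_iff: "enat k \<le> floor_quot j r \<longleftrightarrow> r * k \<le> j"
  by (auto simp: floor_quot_def less_eq_div_iff_mult_less_eq mult.commute)

theorem proposition2p2:
  fixes p q n m :: nat and z w \<gamma> :: complex
  assumes "z \<noteq> 0" and "w \<noteq> 0"
  shows "ito_hermite p q n m z w \<gamma> =
    z ^ n * w ^ m *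
    hypergeom (shifted_params p n @ shifted_params q m) []
      ((- of_nat p) ^ p * (- of_nat q) ^ q * \<gamma> / (z ^ p * w ^ q))"
proof -
  define y where "y = \<gamma> / (z ^ p * w ^ q)"
  define T where "T = hypergeom_term (shifted_params p n @ shifted_params q m) []
      ((- of_nat p) ^ p * (- of_nat q) ^ q * y)"
  define S where "S = {k. enat k \<le> min (floor_quot n p) (floor_quot m q)}"
  have S: "k \<in> S \<longleftrightarrow> p * k \<le> n \<and> q * k \<le> m" for k
    by (simp add: S_def le_floor_quot_iff)
  have abs: "summable (\<lambda>k. norm (T k))"
    unfolding T_def by (rule abs_summable_hypergeom_term_shifted_params)
  \<comment> \<open>Absolute convergence identifies the ordered series of \<open>hypergeom\<close>
    with the unordered sum of \<open>ito_hermite\<close>.\<close>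
  have "(T has_sum suminf T) UNIV"
    using norm_summable_imp_has_sum[OF abs] summable_norm_cancel[OF abs] by (simp add: summable_sums)
  then have "infsum T UNIV = suminf T"
    by (rule infsumI)
  \<comment> \<open>Outside \<open>S\<close> one of the two binomial coefficients vanishes.\<close>
  moreover have "infsum T S = infsum T UNIV"
    by (rule infsum_cong_neutral)
      (auto simp: S T_def hypergeom_term_shifted_params binomial_eq_0)
  moreover have "fact n * fact m * (\<gamma> ^ k / fact k * (z ^ (n - p * k) / fact (n - p * k)) *
      (w ^ (m - q * k) / fact (m - q * k))) = z ^ n * w ^ m * T k" if "k \<in> S" for k
  proof -
    have *: "p * k \<le> n" "q * k \<le> m"
      using that by (auto simp: S)
    \<comment> \<open>On \<open>S\<close> the exponents are not truncated, and \<open>z\<close> and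
      \<open>w\<close> are nonzero, so powers may be divided.\<close>
    have "z ^ n * w ^ m * y ^ k = \<gamma> ^ k * z ^ (n - p * k) * w ^ (m - q * k)"
      using * assms by (simp add: y_def power_divide power_mult_distrib power_diff power_mult)
    then show ?thesis
      unfolding T_def hypergeom_term_shifted_params
        fact_mult_binomial_eq_divide[OF *(1)] fact_mult_binomial_eq_divide[OF *(2)]
      by (simp add: field_simps)
  qed
  \<comment> \<open>The factorials move inside the sum so that the termwise identity applies; then
    \<open>z ^ n * w ^ m\<close> moves out.\<close>
  ultimately have "ito_hermite p q n m z w \<gamma> = z ^ n * w ^ m * suminf T"
    unfolding ito_hermite_def S_def[symmetric] infsum_cmult_right'[symmetric]
    by (simp only: infsum_cmult_right' cong: infsum_cong)
  then show ?thesis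
    by (simp add: hypergeom_def T_def y_def)
qed

end
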